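(* Let $(X,\tau)$ be an extended locally convex space (elcs) with flc topology $\tau_F$. If $(X,\tau_F)$ is reflexive, then $(X,\tau)$ is reflexive. The converse holds if $(X,\tau_F)$ is semi-reflexive; that is, if $(X,\tau)$ is reflexive and $(X,\tau_F)$ is semi-reflexive, then $(X,\tau_F)$ is reflexive.
   Context: Vector spaces are over $\mathbb{K}\in\{\mathbb{R},\mathbb{C}\}$. An extended seminorm on a vector space $X$ is a function $\rho:X\to[0,\infty]$ with $\rho(\alpha x)=|\alpha|\rho(x)$ (convention $0\cdot\infty=0$) and $\rho(x+y)\le\rho(x)+\rho(y)$. An extended locally convex space (elcs) is a vector space $X$ with a Hausdorff topology $\tau$ induced by a family $\mathcal{P}$ of extended seminorms, i.e. the translation-invariant topology for which finite intersections of sets $\{x:\rho(x)<r\}$ ($\rho\in\mathcal{P}$, $r>0$) form a neighborhood base at $0$ (scalar multiplication need not be jointly continuous). The flc topology $\tau_F$ of $(X,\tau)$ is the finest locally convex (vector space) topology on $X$ coarser than $\tau$; $(X,\tau)$ and $(X,\tau_F)$ have the same continuous linear functionals, forming the dual $X^*$. A set $A\subseteq X$ is bounded in an elcs $(X,\tau)$ if for every neighborhood $U$ of $0$ there are $r>0$ and a finite set $F\subseteq X$ with $A\subseteq F+rU$ (for a conventional locally convex space this is ordinary boundedness). $\tau_{ucb}$ is the locally convex topology on $X^*$ induced by the seminorms $\phi\mapsto\sup_{x\in B}|\phi(x)|$, $B$ bounded in $(X,\tau)$. The canonical map is $J:X\to(X^*,\tau_{ucb})^*$, $J(x)=J_x$,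 $J_x(f)=f(x)$. The elcs $(X,\tau)$ is semi-reflexive if $J$ is surjective, and reflexive if $J$ is surjective and continuous from $(X,\tau)$ to $(X^*,\tau_{ucb})^*$ with the topology of uniform convergence on bounded subsets of $(X^*,\tau_{ucb})$. For $(X,\tau_F)$ these are the usual notions for locally convex spaces (with the strong topology on $X^*$). *)

theory Defs
  imports "HOL-Analysis.Analysis" "HOL-Library.Function_Algebras"
begin

text \<open>
  The scalar field is real or complex. Both are instances of the class below, and up to isometric
  isomorphism they are the only ones: the norm of a real normed field is multiplicative, and a
  finite-dimensional commutative division algebra over the reals is real or complex.
\<close>

class real_or_complex = real_normed_field + euclidean_space

instance real :: real_or_complex ..

instance complex :: real_or_complex ..

text \<open>
  A vector space is a linear subspace \<open>V\<close> of a type with scalar multiplication \<open>s\<close>; a topological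
  one is given by a topology whose \<^const>\<open>topspace\<close> is \<open>V\<close>. Proper subspaces have to be allowed
  because the dual of a space is again such a space, inside a type of functions.
\<close>

definition ext_seminorm_on ::
    "('k::real_normed_field \<Rightarrow> 'a::ab_group_add \<Rightarrow> 'a) \<Rightarrow> 'a set \<Rightarrow> ('a \<Rightarrow> ennreal) \<Rightarrow> bool" where
  "ext_seminorm_on s V \<rho> \<longleftrightarrow>
     (\<forall>\<alpha>. \<forall>x\<in>V. \<rho> (s \<alpha> x) = ennreal (norm \<alpha>) * \<rho> x) \<and>
     (\<forall>x\<in>V. \<forall>y\<in>V. \<rho> (x + y) \<le> \<rho> x + \<rho> y)"

definition seminorm_topology :: "'a::ab_group_add set \<Rightarrow> ('a \<Rightarrow> ennreal) set \<Rightarrow> 'a topology" where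
  "seminorm_topology V P = topology (\<lambda>U. U \<subseteq> V \<and>
     (\<forall>x\<in>U. \<exists>F r. finite F \<and> F \<subseteq> P \<and> (r::real) > 0 \<and>
        {y\<in>V. \<forall>\<rho>\<in>F. \<rho> (y - x) < ennreal r} \<subseteq> U))"

lemma openin_seminorm_topology:
  "openin (seminorm_topology V P) U \<longleftrightarrow> U \<subseteq> V \<and>
     (\<forall>x\<in>U. \<exists>F r. finite F \<and> F \<subseteq> P \<and> (r::real) > 0 \<and>
        {y\<in>V. \<forall>\<rho>\<in>F. \<rho> (y - x) < ennreal r} \<subseteq> U)"
proof -
  define B where "B = (\<lambda>F (r::real) x. {y\<in>V. \<forall>\<rho>\<in>F. \<rho> (y - x) < ennreal r})"
  define N where "N = (\<lambda>U x. \<exists>F r. finite F \<and> F \<subseteq> P \<and> (r::real) > 0 \<and> B F r x \<subseteq> U)"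
  have N_mono: "N T x" if "N S x" "S \<subseteq> T" for S T x
    using that unfolding N_def by (meson subset_trans)
  have N_Int: "N (S \<inter> T) x" if S: "N S x" and T: "N T x" for S T x
  proof -
    obtain F r where 1: "finite F" "F \<subseteq> P" "r > 0" "B F r x \<subseteq> S"
      using S unfolding N_def by blast
    obtain G q where 2: "finite G" "G \<subseteq> P" "q > 0" "B G q x \<subseteq> T"
      using T unfolding N_def by blast
    have "ennreal (min r q) \<le> ennreal r" "ennreal (min r q) \<le> ennreal q"
      by (simp_all add: ennreal_leI)
    then have "B (F \<union> G) (min r q) x \<subseteq> B F r x" "B (F \<union> G) (min r q) x \<subseteq> B G q x"
      unfolding B_def by (blast intro: less_le_trans)+
    with 1 2 have "B (F \<union> G) (min r q) x \<subseteq> S \<inter> T" by blast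
    moreover have "finite (F \<union> G)" "F \<union> G \<subseteq> P" "min r q > 0" using 1 2 by auto
    ultimately show ?thesis unfolding N_def by blast
  qed
  have "istopology (\<lambda>U. U \<subseteq> V \<and> (\<forall>x\<in>U. N U x))"
    unfolding istopology_def
  proof (rule conjI; intro allI impI)
    fix S T assume "S \<subseteq> V \<and> (\<forall>x\<in>S. N S x)" "T \<subseteq> V \<and> (\<forall>x\<in>T. N T x)"
    then show "S \<inter> T \<subseteq> V \<and> (\<forall>x\<in>S \<inter> T. N (S \<inter> T) x)"
      using N_Int by blast
  next
    fix \<K> assume K: "\<forall>K\<in>\<K>. K \<subseteq> V \<and> (\<forall>x\<in>K. N K x)"
    then show "\<Union>\<K> \<subseteq> V \<and> (\<forall>x\<in>\<Union>\<K>. N (\<Union>\<K>) x)"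
      using N_mono by (meson Sup_least UnionE Union_upper)
  qed
  then show ?thesis
    unfolding seminorm_topology_def N_def B_def by (rule topology_inverse'[THEN fun_cong])
qed

lemma topspace_seminorm_topology [simp]: "topspace (seminorm_topology V P) = V"
proof -
  have "openin (seminorm_topology V P) V"
    unfolding openin_seminorm_topology by (auto intro!: exI[of _ "{}"] exI[of _ "1::real"])
  moreover have "topspace (seminorm_topology V P) \<subseteq> V"
    using openin_topspace[of "seminorm_topology V P"]
    unfolding openin_seminorm_topology by (rule conjunct1)
  ultimately show ?thesis
    by (intro subset_antisym openin_subset)
qed

definition elcs ::
    "('k::real_normed_field \<Rightarrow> 'a::ab_group_add \<Rightarrow> 'a) \<Rightarrow> 'a topology \<Rightarrow> bool" where
  "elcs s \<tau> \<longleftrightarrow>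
     vector_space s \<and> module.subspace s (topspace \<tau>) \<and> Hausdorff_space \<tau> \<and>
     (\<exists>P. (\<forall>\<rho>\<in>P. ext_seminorm_on s (topspace \<tau>) \<rho>) \<and>
          \<tau> = seminorm_topology (topspace \<tau>) P)"

text \<open>Not required to be Hausdorff.\<close>

definition locally_convex ::
    "('k::real_normed_field \<Rightarrow> 'a::ab_group_add \<Rightarrow> 'a) \<Rightarrow> 'a topology \<Rightarrow> bool" where
  "locally_convex s \<tau> \<longleftrightarrow>
     vector_space s \<and> module.subspace s (topspace \<tau>) \<and>
     (\<exists>P. (\<forall>\<rho>\<in>P. ext_seminorm_on s (topspace \<tau>) \<rho> \<and> (\<forall>x\<in>topspace \<tau>. \<rho> x < \<infinity>)) \<and>
          \<tau> = seminorm_topology (topspace \<tau>) P)"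

definition coarser :: "'a topology \<Rightarrow> 'a topology \<Rightarrow> bool" where
  "coarser \<sigma> \<tau> \<longleftrightarrow> topspace \<sigma> = topspace \<tau> \<and> (\<forall>U. openin \<sigma> U \<longrightarrow> openin \<tau> U)"

definition is_flc_topology ::
    "('k::real_normed_field \<Rightarrow> 'a::ab_group_add \<Rightarrow> 'a) \<Rightarrow> 'a topology \<Rightarrow> 'a topology \<Rightarrow> bool" where
  "is_flc_topology s \<tau> \<tau>F \<longleftrightarrow>
     locally_convex s \<tau>F \<and> coarser \<tau>F \<tau> \<and>
     (\<forall>\<sigma>. locally_convex s \<sigma> \<and> coarser \<sigma> \<tau> \<longrightarrow> coarser \<sigma> \<tau>F)"

text \<open>Hence ``the'' flc topology of an elcs is well defined.\<close>

lemma ex1_flc_topology: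
  fixes s :: "'k::real_normed_field \<Rightarrow> 'a::ab_group_add \<Rightarrow> 'a"
  assumes "elcs s \<tau>"
  shows "\<exists>!\<tau>F. is_flc_topology s \<tau> \<tau>F"
proof (rule ex_ex1I)
  define V where "V = topspace \<tau>"
  have vs: "vector_space s" and sub: "module.subspace s V"
    using assms by (auto simp: elcs_def V_def)
  interpret vector_space s by (rule vs)
  have zero: "\<rho> 0 = 0" if "ext_seminorm_on s V \<rho>" for \<rho>
  proof -
    have "\<rho> (s 0 0) = ennreal (norm (0::'k)) * \<rho> 0"
      using that subspace_0[OF sub] unfolding ext_seminorm_on_def by blast
    then show ?thesis by simp
  qed
  define P where "P = {\<rho>. ext_seminorm_on s V \<rho> \<and> (\<forall>x\<in>V. \<rho> x < \<infinity>) \<and>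
    (\<forall>x\<in>V. \<forall>r>0. openin \<tau> {y\<in>V. \<rho> (y - x) < ennreal r})}"
  define \<sigma> where "\<sigma> = seminorm_topology V P"
  have "locally_convex s \<sigma>"
    unfolding locally_convex_def
  proof (intro conjI exI[of _ P] ballI)
    show "\<sigma> = seminorm_topology (topspace \<sigma>) P" by (simp add: \<sigma>_def)
  qed (use vs sub in \<open>simp_all add: \<sigma>_def P_def\<close>)
  moreover have "coarser \<sigma> \<tau>"
    unfolding coarser_def
  proof (intro conjI allI impI)
    show "topspace \<sigma> = topspace \<tau>" by (simp add: \<sigma>_def V_def)
    fix U assume U: "openin \<sigma> U"
    show "openin \<tau> U"
    proof (subst openin_subopen, intro ballI)
      fix x assume "x \<in> U"
      with U obtain F r where F: "finite F" "F \<subseteq> P" "(r::real) > 0"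
          "{y\<in>V. \<forall>\<rho>\<in>F. \<rho> (y - x) < ennreal r} \<subseteq> U" and "x \<in> V"
        unfolding \<sigma>_def openin_seminorm_topology by blast
      have "{y\<in>V. \<forall>\<rho>\<in>F. \<rho> (y - x) < ennreal r} =
          (\<Inter>\<rho>\<in>F. {y\<in>V. \<rho> (y - x) < ennreal r}) \<inter> topspace \<tau>"
        by (auto simp: V_def)
      moreover have "openin \<tau> ((\<Inter>\<rho>\<in>F. {y\<in>V. \<rho> (y - x) < ennreal r}) \<inter> topspace \<tau>)"
      proof (intro openin_INT)
        show "openin \<tau> {y\<in>V. \<rho> (y - x) < ennreal r}" if "\<rho> \<in> F" for \<rho>
          using that F(2,3) \<open>x \<in> V\<close> unfolding P_def by blast
      qed (rule F(1))
      moreover have "x \<in> {y\<in>V. \<forall>\<rho>\<in>F. \<rho> (y - x) < ennreal r}"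
      proof -
        have "\<rho> 0 < ennreal r" if "\<rho> \<in> F" for \<rho>
        proof -
          have "\<rho> 0 = 0" using zero that F(2) unfolding P_def by blast
          then show ?thesis using F(3) by simp
        qed
        then show ?thesis using \<open>x \<in> V\<close> by simp
      qed
      ultimately show "\<exists>T. openin \<tau> T \<and> x \<in> T \<and> T \<subseteq> U"
        using F(4) by (intro exI[of _ "{y\<in>V. \<forall>\<rho>\<in>F. \<rho> (y - x) < ennreal r}"]) simp
    qed
  qed
  moreover have "coarser \<sigma>' \<sigma>" if lc: "locally_convex s \<sigma>'" and co: "coarser \<sigma>' \<tau>" for \<sigma>'
  proof -
    have V: "topspace \<sigma>' = V" using co by (simp add: coarser_def V_def)
    obtain Q where Q: "\<And>\<rho>. \<rho> \<in> Q \<Longrightarrow> ext_seminorm_on s V \<rho> \<and> (\<forall>x\<in>V. \<rho> x < \<infinity>)"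
        and \<sigma>': "\<sigma>' = seminorm_topology V Q"
      using lc unfolding locally_convex_def V by blast
    have "Q \<subseteq> P"
    proof
      fix \<rho> assume \<rho>: "\<rho> \<in> Q"
      have "openin \<sigma>' {y\<in>V. \<rho> (y - x) < ennreal r}" if "x \<in> V" "r > 0" for x r
        unfolding \<sigma>' openin_seminorm_topology
      proof (intro conjI ballI)
        fix z assume "z \<in> {y\<in>V. \<rho> (y - x) < ennreal r}"
        then have z: "z \<in> V" "\<rho> (z - x) < ennreal r" by auto
        then obtain a where a: "\<rho> (z - x) = ennreal a" "0 \<le> a" "a < r"
          using \<open>r > 0\<close> by (cases "\<rho> (z - x)") (auto simp: ennreal_less_iff)
        have "\<rho> (y - x) < ennreal r" if "y \<in> V" "\<rho> (y - z) < ennreal (r - a)" for y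
        proof -
          have "\<rho> ((y - z) + (z - x)) \<le> \<rho> (y - z) + \<rho> (z - x)"
            using Q[OF \<rho>] z \<open>x \<in> V\<close> that subspace_diff[OF sub]
            unfolding ext_seminorm_on_def by blast
          also have "\<dots> < ennreal (r - a) + ennreal a"
            using that a by (cases "\<rho> (y - z)") (auto simp: ennreal_less_iff simp flip: ennreal_plus)
          also have "\<dots> = ennreal r"
            using a by (simp flip: ennreal_plus)
          finally show ?thesis by simp
        qed
        then show "\<exists>F q. finite F \<and> F \<subseteq> Q \<and> (q::real) > 0 \<and>
            {y\<in>V. \<forall>\<rho>\<in>F. \<rho> (y - z) < ennreal q} \<subseteq> {y\<in>V. \<rho> (y - x) < ennreal r}"
          using \<rho> a by (intro exI[of _ "{\<rho>}"] exI[of _ "r - a"]) auto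
      qed auto
      then have "openin \<tau> {y\<in>V. \<rho> (y - x) < ennreal r}" if "x \<in> V" "r > 0" for x r
        using co that unfolding coarser_def by metis
      with Q[OF \<rho>] show "\<rho> \<in> P"
        unfolding P_def by (intro CollectI conjI) auto
    qed
    have "openin \<sigma> U" if U: "openin \<sigma>' U" for U
      unfolding \<sigma>_def openin_seminorm_topology
    proof (intro conjI ballI)
      show "U \<subseteq> V" using openin_subset[OF U] V by simp
      fix x assume "x \<in> U"
      then obtain F r where "finite F" "F \<subseteq> Q" "(r::real) > 0"
          "{y\<in>V. \<forall>\<rho>\<in>F. \<rho> (y - x) < ennreal r} \<subseteq> U"
        using U unfolding \<sigma>' openin_seminorm_topology by blast
      with \<open>Q \<subseteq> P\<close> show "\<exists>F r. finite F \<and> F \<subseteq> P \<and> (r::real) > 0 \<and>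
          {y\<in>V. \<forall>\<rho>\<in>F. \<rho> (y - x) < ennreal r} \<subseteq> U"
        by (intro exI[of _ F] exI[of _ r]) (simp add: subset_trans)
    qed
    then show ?thesis
      unfolding coarser_def V by (simp add: \<sigma>_def)
  qed
  ultimately show "\<exists>\<tau>F. is_flc_topology s \<tau> \<tau>F"
    unfolding is_flc_topology_def by (intro exI[of _ \<sigma>] conjI allI impI) auto
next
  fix \<sigma> \<sigma>' assume "is_flc_topology s \<tau> \<sigma>" "is_flc_topology s \<tau> \<sigma>'"
  then have "coarser \<sigma> \<sigma>'" "coarser \<sigma>' \<sigma>"
    unfolding is_flc_topology_def by auto
  then show "\<sigma> = \<sigma>'"
    unfolding topology_eq by (auto simp: coarser_def)
qed

definition bounded_in ::
    "('k::real_normed_field \<Rightarrow> 'a::ab_group_add \<Rightarrow> 'a) \<Rightarrow> 'a topology \<Rightarrow> 'a set \<Rightarrow> bool" where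
  "bounded_in s \<tau> A \<longleftrightarrow> A \<subseteq> topspace \<tau> \<and>
     (\<forall>U. U \<subseteq> topspace \<tau> \<and> (\<exists>W. openin \<tau> W \<and> 0 \<in> W \<and> W \<subseteq> U) \<longrightarrow>
        (\<exists>F r. finite F \<and> F \<subseteq> topspace \<tau> \<and> (r::real) > 0 \<and>
           A \<subseteq> {a + s (of_real r) u | a u. a \<in> F \<and> u \<in> U}))"

text \<open>
  Functionals are normalised to be 0 outside the space, so that they correspond exactly to
  functions on \<^term>\<open>topspace \<tau>\<close> and form a linear subspace of the type of all functions.
\<close>

definition dual ::
    "('k::real_normed_field \<Rightarrow> 'a::ab_group_add \<Rightarrow> 'a) \<Rightarrow> 'a topology \<Rightarrow> ('a \<Rightarrow> 'k) set" where
  "dual s \<tau> = {\<phi>.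
     (\<forall>x\<in>topspace \<tau>. \<forall>y\<in>topspace \<tau>. \<phi> (x + y) = \<phi> x + \<phi> y) \<and>
     (\<forall>\<alpha>. \<forall>x\<in>topspace \<tau>. \<phi> (s \<alpha> x) = \<alpha> * \<phi> x) \<and>
     continuous_map \<tau> euclidean \<phi> \<and>
     (\<forall>x. x \<notin> topspace \<tau> \<longrightarrow> \<phi> x = 0)}"

definition fscale :: "'k::real_normed_field \<Rightarrow> ('b \<Rightarrow> 'k) \<Rightarrow> 'b \<Rightarrow> 'k" where
  "fscale \<alpha> \<phi> = (\<lambda>x. \<alpha> * \<phi> x)"

definition ucb_topology ::
    "('k::real_normed_field \<Rightarrow> 'a::ab_group_add \<Rightarrow> 'a) \<Rightarrow> 'a topology \<Rightarrow> ('a \<Rightarrow> 'k) topology" where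
  "ucb_topology s \<tau> =
     seminorm_topology (dual s \<tau>) {(\<lambda>\<phi>. SUP x\<in>B. ennreal (norm (\<phi> x))) | B. bounded_in s \<tau> B}"

definition canonical_map ::
    "('k::real_normed_field \<Rightarrow> 'a::ab_group_add \<Rightarrow> 'a) \<Rightarrow> 'a topology \<Rightarrow> 'a \<Rightarrow> ('a \<Rightarrow> 'k) \<Rightarrow> 'k" where
  "canonical_map s \<tau> x = (\<lambda>f. if f \<in> dual s \<tau> then f x else 0)"

definition semi_reflexive ::
    "('k::real_normed_field \<Rightarrow> 'a::ab_group_add \<Rightarrow> 'a) \<Rightarrow> 'a topology \<Rightarrow> bool" where
  "semi_reflexive s \<tau> \<longleftrightarrow>
     canonical_map s \<tau> ` topspace \<tau> = dual fscale (ucb_topology s \<tau>)"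

definition reflexive_space ::
    "('k::real_normed_field \<Rightarrow> 'a::ab_group_add \<Rightarrow> 'a) \<Rightarrow> 'a topology \<Rightarrow> bool" where
  "reflexive_space s \<tau> \<longleftrightarrow> semi_reflexive s \<tau> \<and>
     continuous_map \<tau> (ucb_topology fscale (ucb_topology s \<tau>)) (canonical_map s \<tau>)"

end

theory Submission
  imports Defs
begin

text \<open>
  Everything rests on one fact: if \<open>(X, \<tau>F)\<close> is semi-reflexive, every pointwise bounded set of
  functionals is uniformly bounded on bounded sets. This is a gliding hump argument, in which
  completeness is replaced by semi-reflexivity: for points \<open>x\<^sub>j\<close> of a bounded set and absolutely
  summable \<open>c\<^sub>j\<close>, the functional \<open>\<phi> \<mapsto> \<Sum>\<^sub>j c\<^sub>j \<phi>(x\<^sub>j)\<close> is strongly continuous, hence is evaluation at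
  a point of \<open>X\<close>. Consequently the two topologies on the common dual have the same bounded sets, and
  the two biduals coincide topologically. The topology which the canonical map pulls back from the
  bidual is locally convex, so by the universal property of \<open>\<tau>F\<close> the canonical map is continuous
  for \<open>\<tau>\<close> iff it is continuous for \<open>\<tau>F\<close>.
\<close>

section \<open>Topologies given by suprema\<close>

lemma seminorm_topology_mono:
  assumes "P \<subseteq> Q"
  shows "coarser (seminorm_topology V P) (seminorm_topology V Q)"
  unfolding coarser_def
proof (intro conjI allI impI)
  fix U assume "openin (seminorm_topology V P) U"
  then show "openin (seminorm_topology V Q) U"
    using assms unfolding openin_seminorm_topology by (meson subset_trans)
qed simp

lemma continuous_map_coarser_domain:
  assumes "coarser \<sigma> \<tau>" "continuous_map \<sigma> T f"
  shows "continuous_map \<tau> T f"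
  using assms by (simp add: coarser_def continuous_map_def)

lemma SUP_ennreal_norm_lessD:
  fixes f :: "'b \<Rightarrow> 'k::real_normed_vector"
  assumes "(SUP x\<in>B. ennreal (norm (f x))) < ennreal r" "x \<in> B"
  shows "norm (f x) < r"
proof -
  have "ennreal (norm (f x)) \<le> (SUP x\<in>B. ennreal (norm (f x)))"
    using assms(2) by (rule SUP_upper)
  with assms(1) have "ennreal (norm (f x)) < ennreal r" by simp
  then show ?thesis by (simp add: ennreal_less_iff)
qed

lemma SUP_ennreal_norm_lessI:
  fixes f :: "'b \<Rightarrow> 'k::real_normed_vector"
  assumes "\<And>x. x \<in> B \<Longrightarrow> norm (f x) \<le> q" "0 \<le> q" "q < r"
  shows "(SUP x\<in>B. ennreal (norm (f x))) < ennreal r"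
proof -
  have "(SUP x\<in>B. ennreal (norm (f x))) \<le> ennreal q"
    using assms(1) by (intro SUP_least ennreal_leI)
  also have "\<dots> < ennreal r"
    using assms(2,3) by (simp add: ennreal_less_iff)
  finally show ?thesis .
qed

text \<open>Continuity from a Lipschitz estimate against a single seminorm. The real bound
  \<open>r\<close> stands in for the value \<open>\<rho> (y - x)\<close>, which may be infinite for
  other pairs of points.\<close>

lemma continuous_map_seminorm_topologyI:
  fixes f :: "'a::ab_group_add \<Rightarrow> 'k::real_normed_vector"
  assumes "\<rho> \<in> P"
    and lip: "\<And>x y r. x \<in> V \<Longrightarrow> y \<in> V \<Longrightarrow> r > 0 \<Longrightarrow> \<rho> (y - x) < ennreal r \<Longrightarrow>
      norm (f y - f x) \<le> M * r"
  shows "continuous_map (seminorm_topology V P) euclidean f"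
  unfolding continuous_map
proof (intro conjI allI impI)
  fix S :: "'k set" assume "openin euclidean S"
  then have S: "open S" by simp
  show "openin (seminorm_topology V P) {x \<in> topspace (seminorm_topology V P). f x \<in> S}"
    unfolding openin_seminorm_topology topspace_seminorm_topology
  proof (intro conjI ballI)
    fix x assume x: "x \<in> {x \<in> V. f x \<in> S}"
    then obtain e where e: "e > 0" "ball (f x) e \<subseteq> S"
      using S open_contains_ball by blast
    \<comment> \<open>The summand 1 keeps the divisor positive and makes
      \<open>\<bar>M\<bar> * r < e\<close> strict; \<open>M\<close> may have any sign.\<close>
    define r where "r = e / (\<bar>M\<bar> + 1)"
    have r: "r > 0" using e by (simp add: r_def)
    have "\<bar>M\<bar> * r < (\<bar>M\<bar> + 1) * r" using r by simp
    also have "\<dots> = e" by (simp add: r_def)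
    finally have Mr: "\<bar>M\<bar> * r < e" .
    have "f y \<in> S" if y: "y \<in> V" "\<rho> (y - x) < ennreal r" for y
    proof -
      have "norm (f y - f x) \<le> M * r" using lip x y r by simp
      also have "\<dots> \<le> \<bar>M\<bar> * r" using r by simp
      finally have "norm (f y - f x) < e" using Mr by simp
      then show ?thesis
        using e(2) by (auto simp: dist_norm norm_minus_commute)
    qed
    then show "\<exists>F r. finite F \<and> F \<subseteq> P \<and> (r::real) > 0 \<and>
        {y \<in> V. \<forall>\<rho>\<in>F. \<rho> (y - x) < ennreal r} \<subseteq> {x \<in> V. f x \<in> S}"
      using r assms(1) by (intro exI[of _ "{\<rho>}"] exI[of _ r]) auto
  qed auto
qed auto

section \<open>The dual space\<close>

lemma dual_zero: "0 \<in> dual s \<tau>"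
  by (simp add: dual_def zero_fun_def)

lemma dual_coarser:
  assumes "coarser \<sigma> \<tau>"
  shows "dual s \<sigma> \<subseteq> dual s \<tau>"
proof
  fix f assume f: "f \<in> dual s \<sigma>"
  then have "continuous_map \<sigma> euclidean f" by (simp add: dual_def)
  then have "continuous_map \<tau> euclidean f" by (rule continuous_map_coarser_domain[OF assms])
  moreover have "topspace \<sigma> = topspace \<tau>" using assms by (simp add: coarser_def)
  ultimately show "f \<in> dual s \<tau>" using f by (simp add: dual_def)
qed

lemma dual_add:
  assumes "f \<in> dual s \<tau>" "g \<in> dual s \<tau>"
  shows "f + g \<in> dual s \<tau>"
  using assms
  by (auto simp: dual_def plus_fun_def algebra_simps intro: continuous_map_add)

lemma dual_fscale:
  assumes "f \<in> dual s \<tau>"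
  shows "fscale c f \<in> dual s \<tau>"
proof -
  have "continuous_map \<tau> euclidean f" using assms by (simp add: dual_def)
  moreover have "continuous_map euclidean euclidean ((*) c)"
    by (simp add: continuous_intros)
  ultimately have "continuous_map \<tau> euclidean ((*) c \<circ> f)"
    by (rule continuous_map_compose)
  then have "continuous_map \<tau> euclidean (fscale c f)"
    by (simp add: fscale_def o_def)
  then show ?thesis
    using assms by (auto simp: dual_def fscale_def algebra_simps)
qed

lemma dual_diff:
  assumes "vector_space s" "module.subspace s (topspace \<tau>)" "f \<in> dual s \<tau>"
    and "x \<in> topspace \<tau>" "y \<in> topspace \<tau>"
  shows "f (x - y) = f x - f y"
proof -
  interpret vector_space s by fact
  have "x - y \<in> topspace \<tau>" using assms subspace_diff by blast
  then have "f ((x - y) + y) = f (x - y) + f y"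
    using assms unfolding dual_def by blast
  then show ?thesis by simp
qed

lemma topspace_ucb_topology [simp]: "topspace (ucb_topology s \<tau>) = dual s \<tau>"
  by (simp add: ucb_topology_def)

lemma bounded_in_singleton:
  assumes "vector_space s" "x \<in> topspace \<tau>"
  shows "bounded_in s \<tau> {x}"
proof -
  interpret vector_space s by fact
  have "\<exists>F r. finite F \<and> F \<subseteq> topspace \<tau> \<and> (r::real) > 0 \<and>
      {x} \<subseteq> {a + s (of_real r) u |a u. a \<in> F \<and> u \<in> U}" if "0 \<in> U" for U
  proof (intro exI conjI)
    have "x = x + s (of_real 1) 0" by simp
    with that show "{x} \<subseteq> {a + s (of_real 1) u |a u. a \<in> {x} \<and> u \<in> U}" by blast
  qed (use assms(2) in auto)
  then show ?thesis
    using assms(2) unfolding bounded_in_def by blast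
qed

lemma bounded_in_coarser:
  assumes "coarser \<sigma> \<tau>" "bounded_in s \<tau> A"
  shows "bounded_in s \<sigma> A"
proof -
  have top: "topspace \<sigma> = topspace \<tau>" and "\<And>W. openin \<sigma> W \<Longrightarrow> openin \<tau> W"
    using assms(1) by (auto simp: coarser_def)
  then have nbhd: "U \<subseteq> topspace \<tau> \<and> (\<exists>W. openin \<tau> W \<and> 0 \<in> W \<and> W \<subseteq> U)"
    if "U \<subseteq> topspace \<tau> \<and> (\<exists>W. openin \<sigma> W \<and> 0 \<in> W \<and> W \<subseteq> U)" for U
    using that by blast
  show ?thesis
    unfolding bounded_in_def top
  proof (intro conjI allI impI, goal_cases)
    case 1
    then show ?case using assms(2) by (simp add: bounded_in_def)
  next
    case (2 U)
    then show ?case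
      using assms(2) nbhd[of U] unfolding bounded_in_def by simp
  qed
qed

text \<open>The preimage \<open>U\<close> of the unit ball is a neighbourhood of 0, so
  \<open>B\<close> is covered by finitely many translates of \<open>r\<close> times
  \<open>U\<close>, where \<open>f\<close> is bounded by its values on \<open>F\<close> plus
  \<open>r\<close>. Zero and closure under scaling are all that is asked of the space, so the lemma
  serves both for \<open>s\<close> on the space and for \<open>fscale\<close> on its dual.\<close>

lemma dual_bounded_on_bounded_in:
  fixes s :: "'k::real_normed_field \<Rightarrow> 'a::ab_group_add \<Rightarrow> 'a"
  assumes zero: "0 \<in> topspace \<tau>"
    and scale: "\<And>c x. x \<in> topspace \<tau> \<Longrightarrow> s c x \<in> topspace \<tau>"
    and f: "f \<in> dual s \<tau>" and B: "bounded_in s \<tau> B"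
  shows "\<exists>C. \<forall>x\<in>B. norm (f x) \<le> C"
proof -
  define U where "U = {x \<in> topspace \<tau>. f x \<in> ball 0 1}"
  have "continuous_map \<tau> euclidean f" using f by (simp add: dual_def)
  then have U: "openin \<tau> U"
    unfolding U_def by (rule openin_continuous_map_preimage) simp
  have "f (0 + 0) = f 0 + f 0" using f zero unfolding dual_def by blast
  then have "0 \<in> U" using zero by (simp add: U_def)
  moreover have "U \<subseteq> topspace \<tau>" by (auto simp: U_def)
  ultimately obtain F r where F: "finite F" "F \<subseteq> topspace \<tau>" "(r::real) > 0"
      "B \<subseteq> {a + s (of_real r) u | a u. a \<in> F \<and> u \<in> U}"
    using B U unfolding bounded_in_def by blast
  have "norm (f x) \<le> (\<Sum>a\<in>F. norm (f a)) + r" if x: "x \<in> B" for x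
  proof -
    obtain a u where au: "x = a + s (of_real r) u" "a \<in> F" "u \<in> U"
      using F(4) x by blast
    have u: "u \<in> topspace \<tau>" "norm (f u) < 1" using au(3) by (auto simp: U_def)
    have "f x = f a + of_real r * f u"
      using f au F(2) u scale unfolding dual_def by auto
    then have "norm (f x) \<le> norm (f a) + norm (of_real r * f u)"
      by (simp add: norm_triangle_ineq)
    also have "norm (of_real r * f u) \<le> r"
      using F(3) u(2) by (simp add: norm_mult)
    also have "norm (f a) \<le> (\<Sum>a\<in>F. norm (f a))"
      using au(2) F(1) by (intro member_le_sum) auto
    finally show ?thesis by simp
  qed
  then show ?thesis by blast
qed

text \<open>The functional is Lipschitz with constant \<open>\<Sum>j. norm (c j)\<close> against the
  supremum over \<open>B\<close>, which is one of the seminorms defining the topology of the dual.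
  The series converge because a continuous functional is bounded on \<open>B\<close> and the scalars
  are complete.\<close>

lemma weighted_sum_in_bidual:
  fixes s :: "'k::{real_normed_field,banach} \<Rightarrow> 'a::ab_group_add \<Rightarrow> 'a"
  assumes vs: "vector_space s" and sub: "module.subspace s (topspace \<tau>)"
    and B: "bounded_in s \<tau> B" and x: "\<And>j. x j \<in> B"
    and c: "summable (\<lambda>j::nat. norm (c j))"
  shows "(\<lambda>f. if f \<in> dual s \<tau> then \<Sum>j. c j * f (x j) else 0) \<in> dual fscale (ucb_topology s \<tau>)"
    (is "?\<Phi> \<in> _")
proof -
  interpret vector_space s by (rule vs)
  have sm: "summable (\<lambda>j. c j * f (x j))" if f: "f \<in> dual s \<tau>" for f
  proof -
    obtain C where C: "\<forall>y\<in>B. norm (f y) \<le> C"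
      using dual_bounded_on_bounded_in[OF subspace_0[OF sub] subspace_scale[OF sub] f B] by blast
    have "summable (\<lambda>j. norm (c j) * C)" using c by (rule summable_mult2)
    then show ?thesis
      by (rule summable_comparison_test')
        (use C x in \<open>auto simp: norm_mult intro: mult_left_mono\<close>)
  qed
  have "continuous_map (ucb_topology s \<tau>) euclidean ?\<Phi>"
    unfolding ucb_topology_def
  proof (rule continuous_map_seminorm_topologyI)
    show "(\<lambda>f. SUP y\<in>B. ennreal (norm (f y))) \<in>
        {\<lambda>f. SUP y\<in>B. ennreal (norm (f y)) |B. bounded_in s \<tau> B}"
      using B by blast
    fix f g :: "'a \<Rightarrow> 'k" and r
    assume fg: "f \<in> dual s \<tau>" "g \<in> dual s \<tau>" "r > 0"
      and less: "(SUP y\<in>B. ennreal (norm ((g - f) y))) < ennreal r"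
    have le: "norm (g (x j) - f (x j)) \<le> r" for j
      using SUP_ennreal_norm_lessD[OF less x[of j]] by simp
    have "?\<Phi> g - ?\<Phi> f = (\<Sum>j. c j * (g (x j) - f (x j)))"
      using fg sm by (simp add: suminf_diff algebra_simps)
    also have "norm \<dots> \<le> (\<Sum>j. norm (c j) * r)"
      using le by (intro norm_suminf_le summable_mult2 c) (simp add: norm_mult mult_left_mono)
    also have "\<dots> = (\<Sum>j. norm (c j)) * r"
      by (rule suminf_mult2[symmetric, OF c])
    finally show "norm (?\<Phi> g - ?\<Phi> f) \<le> (\<Sum>j. norm (c j)) * r" .
  qed
  moreover have "(\<Sum>j. c j * (f + g) (x j)) = (\<Sum>j. c j * f (x j)) + (\<Sum>j. c j * g (x j))"
    if "f \<in> dual s \<tau>" "g \<in> dual s \<tau>" for f g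
    using suminf_add[OF sm[OF that(1)] sm[OF that(2)]] by (simp add: distrib_left)
  moreover have "(\<Sum>j. c j * fscale \<alpha> f (x j)) = \<alpha> * (\<Sum>j. c j * f (x j))"
    if "f \<in> dual s \<tau>" for \<alpha> f
    using suminf_mult[OF sm[OF that], of \<alpha>] by (simp add: fscale_def mult.left_commute)
  ultimately show ?thesis
    unfolding dual_def[of fscale] topspace_ucb_topology
    by (simp del: plus_fun_apply add: dual_add dual_fscale)
qed

text \<open>Evaluation at \<open>x\<close> is the weighted sum over the bounded set
  \<open>{x}\<close> with weights 1, 0, 0, and so on.\<close>

lemma canonical_map_in_bidual:
  fixes s :: "'k::{real_normed_field,banach} \<Rightarrow> 'a::ab_group_add \<Rightarrow> 'a"
  assumes "vector_space s" "module.subspace s (topspace \<tau>)" "x \<in> topspace \<tau>"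
  shows "canonical_map s \<tau> x \<in> dual fscale (ucb_topology s \<tau>)"
proof -
  define c :: "nat \<Rightarrow> 'k" where "c j = (if j = 0 then 1 else 0)" for j
  have "summable (\<lambda>j. norm (c j))"
    by (rule summable_finite[of "{0}"]) (auto simp: c_def)
  then have *: "(\<lambda>f. if f \<in> dual s \<tau> then \<Sum>j. c j * f x else 0) \<in> dual fscale (ucb_topology s \<tau>)"
    using assms by (intro weighted_sum_in_bidual[where B = "{x}"] bounded_in_singleton) auto
  have c_sum: "(\<Sum>j. c j * z) = z" for z
    by (subst suminf_finite[of "{0}"]) (auto simp: c_def)
  show ?thesis using * unfolding c_sum canonical_map_def .
qed

text \<open>Evaluation at \<open>x\<close> is a continuous functional on the dual, and such
  functionals are bounded on bounded sets.\<close>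

lemma bounded_in_ucb_imp_pointwise_bounded:
  fixes s :: "'k::{real_normed_field,banach} \<Rightarrow> 'a::ab_group_add \<Rightarrow> 'a"
  assumes vs: "vector_space s" and sub: "module.subspace s (topspace \<tau>)"
    and H: "bounded_in fscale (ucb_topology s \<tau>) H" and x: "x \<in> topspace \<tau>"
  shows "\<exists>C. \<forall>f\<in>H. norm (f x) \<le> C"
proof -
  have "\<exists>C. \<forall>f\<in>H. norm (canonical_map s \<tau> x f) \<le> C"
    by (rule dual_bounded_on_bounded_in[OF _ _ canonical_map_in_bidual[OF vs sub x] H])
      (simp_all add: dual_zero dual_fscale)
  then obtain C where C: "\<forall>f\<in>H. norm (canonical_map s \<tau> x f) \<le> C" ..
  have "norm (f x) \<le> C" if f: "f \<in> H" for f
  proof -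
    have "f \<in> dual s \<tau>" using H f unfolding bounded_in_def by auto
    then have "canonical_map s \<tau> x f = f x" by (simp add: canonical_map_def)
    then show ?thesis using C f by metis
  qed
  then show ?thesis by blast
qed

text \<open>A basic neighbourhood of 0 restricts only finitely many suprema. A common bound for
  these lets a single scaling absorb \<open>H\<close>, with \<open>{0}\<close> as the finite set of
  translates.\<close>

lemma uniformly_bounded_imp_bounded_in_ucb:
  fixes s :: "'k::real_normed_field \<Rightarrow> 'a::ab_group_add \<Rightarrow> 'a"
  assumes H: "H \<subseteq> dual s \<tau>"
    and bd: "\<And>B. bounded_in s \<tau> B \<Longrightarrow> \<exists>C. \<forall>f\<in>H. \<forall>x\<in>B. norm (f x) \<le> C"
  shows "bounded_in fscale (ucb_topology s \<tau>) H"
  unfolding bounded_in_def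
proof (intro conjI allI impI)
  show "H \<subseteq> topspace (ucb_topology s \<tau>)" using H by simp
  fix U assume "U \<subseteq> topspace (ucb_topology s \<tau>) \<and>
    (\<exists>W. openin (ucb_topology s \<tau>) W \<and> 0 \<in> W \<and> W \<subseteq> U)"
  then obtain W where W: "openin (ucb_topology s \<tau>) W" "0 \<in> W" "W \<subseteq> U" by blast
  define p where "p B f = (SUP x\<in>B. ennreal (norm (f x)))" for B and f :: "'a \<Rightarrow> 'k"
  have fam: "{\<lambda>f::'a \<Rightarrow> 'k. SUP x\<in>B. ennreal (norm (f x)) |B. bounded_in s \<tau> B}
      = p ` {B. bounded_in s \<tau> B}"
    by (auto simp: p_def fun_eq_iff)
  obtain F r where F: "finite F" "F \<subseteq> p ` {B. bounded_in s \<tau> B}" "(r::real) > 0"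
      "{f\<in>dual s \<tau>. \<forall>\<rho>\<in>F. \<rho> (f - 0) < ennreal r} \<subseteq> W"
    using W(1,2) unfolding ucb_topology_def openin_seminorm_topology fam by blast
  obtain G where G: "finite G" "G \<subseteq> {B. bounded_in s \<tau> B}" "F = p ` G"
    using finite_subset_image[OF F(1,2)] by blast
  from G(1,2) have "\<exists>C>0. \<forall>f\<in>H. \<forall>B\<in>G. \<forall>x\<in>B. norm (f x) \<le> C"
  proof (induction G rule: finite_induct)
    case empty
    then show ?case by (auto intro: exI[of _ "1::real"])
  next
    case (insert B G)
    then have "\<exists>C>0. \<forall>f\<in>H. \<forall>B\<in>G. \<forall>x\<in>B. norm (f x) \<le> C" by blast
    then obtain C where C: "C > 0" "\<forall>f\<in>H. \<forall>B\<in>G. \<forall>x\<in>B. norm (f x) \<le> C" by blast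
    have "bounded_in s \<tau> B" using insert.prems by simp
    from bd[OF this] obtain D where D: "\<forall>f\<in>H. \<forall>x\<in>B. norm (f x) \<le> D" by blast
    have "norm (f x) \<le> max C D" if "f \<in> H" "A \<in> insert B G" "x \<in> A" for f A x
      using that C(2) D by (cases "A = B") (simp_all add: le_max_iff_disj)
    moreover have "max C D > 0" using C(1) by simp
    ultimately show ?case by blast
  qed
  then obtain C where C: "C > 0" "\<And>f B x. f \<in> H \<Longrightarrow> B \<in> G \<Longrightarrow> x \<in> B \<Longrightarrow> norm (f x) \<le> C"
    by blast
  \<comment> \<open>Scaled by \<open>1 / t\<close>, the members of \<open>H\<close> are at most
    \<open>r / 2\<close> on the sets in \<open>G\<close>; the factor 2 is the slack that makes the
    suprema strictly less than \<open>r\<close>.\<close>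
  define t where "t = 2 * C / r"
  have t: "t > 0" using C F(3) by (simp add: t_def)
  have "fscale (of_real (1 / t)) f \<in> W" if "f \<in> H" for f
  proof -
    have "p B (fscale (of_real (1 / t)) f) < ennreal r" if "B \<in> G" for B
      unfolding p_def
    proof (rule SUP_ennreal_norm_lessI[of _ _ "r / 2"])
      fix x assume "x \<in> B"
      then have "norm (f x) \<le> C" using C \<open>f \<in> H\<close> that by blast
      then have "norm (f x) / t \<le> C / t" using t by (simp add: divide_right_mono)
      also have "C / t = r / 2" using C F(3) by (simp add: t_def)
      finally show "norm (fscale (of_real (1 / t)) f x) \<le> r / 2"
        using t by (simp add: fscale_def norm_mult norm_divide)
    qed (use F(3) in auto)
    then show ?thesis
      using F(4) G(3) H that by (auto intro!: dual_fscale)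
  qed
  moreover have "f = 0 + fscale (of_real t) (fscale (of_real (1 / t)) f)" for f :: "'a \<Rightarrow> 'k"
    using t by (simp add: fscale_def fun_eq_iff)
  ultimately have "H \<subseteq> {a + fscale (of_real t) u |a u. a \<in> {0} \<and> u \<in> U}"
    using W(3) by blast
  then show "\<exists>F r. finite F \<and> F \<subseteq> topspace (ucb_topology s \<tau>) \<and> (r::real) > 0 \<and>
      H \<subseteq> {a + fscale (of_real r) u |a u. a \<in> F \<and> u \<in> U}"
    using t by (intro exI[of _ "{0}"] exI[of _ t]) (simp add: dual_zero)
qed

section \<open>The gliding hump\<close>

text \<open>The signs 1 and -1 suffice: with \<open>S\<close> the sum of the earlier terms,
  \<open>S + a n n\<close> and \<open>S - a n n\<close> differ by \<open>2 * a n n\<close>, so one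
  of them has norm at least \<open>norm (a n n)\<close>. The choice at \<open>n\<close> depends on
  earlier signs only, so it can be made recursively.\<close>

lemma ex_signs_partial_sum_ge_diagonal:
  fixes a :: "nat \<Rightarrow> nat \<Rightarrow> 'k::real_normed_field"
  shows "\<exists>\<epsilon>. \<forall>n. norm (\<epsilon> n) = 1 \<and> norm (a n n) \<le> norm (\<Sum>j<Suc n. \<epsilon> j * a n j)"
proof -
  define Q where "Q \<epsilon> n r \<longleftrightarrow>
    norm r = 1 \<and> norm (a n n) \<le> norm ((\<Sum>j<n. \<epsilon> j * a n j) + r * a n n)" for \<epsilon> n r
  have "\<exists>\<epsilon>. \<forall>n. Q \<epsilon> n (\<epsilon> n)"
  proof (rule dependent_wf_choice[OF wf_less_than])
    fix \<epsilon> \<epsilon>' :: "nat \<Rightarrow> 'k" and n r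
    assume "\<And>j. (j, n) \<in> less_than \<Longrightarrow> \<epsilon> j = \<epsilon>' j"
    then show "Q \<epsilon> n r = Q \<epsilon>' n r" by (simp add: Q_def)
  next
    fix \<epsilon> :: "nat \<Rightarrow> 'k" and n
    define S where "S = (\<Sum>j<n. \<epsilon> j * a n j)"
    have "2 * a n n = (S + a n n) - (S - a n n)" by simp
    then have "norm (2 * a n n) \<le> norm (S + a n n) + norm (S - a n n)"
      by (metis norm_triangle_ineq4)
    then have "2 * norm (a n n) \<le> norm (S + a n n) + norm (S - a n n)"
      by (simp add: norm_mult)
    then have "Q \<epsilon> n 1 \<or> Q \<epsilon> n (- 1)"
      by (auto simp: Q_def S_def)
    then show "\<exists>r. Q \<epsilon> n r" by blast
  qed
  then show ?thesis by (simp add: Q_def)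
qed

text \<open>Functionals \<open>f n\<close> whose supremum \<open>p (f n)\<close> over
  \<open>B\<close> exceeds \<open>4 ^ n\<close> are tested at the point \<open>y\<close> that
  represents a sum with weights of norm \<open>(1 / 3) ^ j\<close>. In units of
  \<open>(1 / 3) ^ n * p (f n)\<close>, the signs keep the terms up to \<open>n\<close> at 3/4 or
  more in total, while the tail is at most 1/2. Hence \<open>norm (f n y)\<close> is at least
  \<open>1 / 4 * (4 / 3) ^ n\<close>, against pointwise boundedness at \<open>y\<close>.\<close>

lemma pointwise_bounded_imp_uniformly_bounded:
  fixes s :: "'k::{real_normed_field,banach} \<Rightarrow> 'a::ab_group_add \<Rightarrow> 'a"
  assumes vs: "vector_space s" and sub: "module.subspace s (topspace \<tau>)"
    and sr: "semi_reflexive s \<tau>" and B: "bounded_in s \<tau> B" and H: "H \<subseteq> dual s \<tau>"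
    and pw: "\<And>x. x \<in> topspace \<tau> \<Longrightarrow> \<exists>C. \<forall>f\<in>H. norm (f x) \<le> C"
  shows "\<exists>C. \<forall>f\<in>H. \<forall>x\<in>B. norm (f x) \<le> C"
proof (rule ccontr)
  interpret vector_space s by (rule vs)
  assume "\<nexists>C. \<forall>f\<in>H. \<forall>x\<in>B. norm (f x) \<le> C"
  then have unbd: "\<exists>f\<in>H. \<exists>x\<in>B. norm (f x) > C" for C by (meson not_le)
  \<comment> \<open>A real supremum, convenient for the estimates below; it is meaningful on
    \<open>H\<close> because each single functional is bounded on \<open>B\<close>.\<close>
  define p where "p f = (SUP x\<in>B. norm (f x))" for f :: "'a \<Rightarrow> 'k"
  have bdd: "bdd_above ((\<lambda>x. norm (f x)) ` B)" if "f \<in> H" for f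
  proof -
    have f: "f \<in> dual s \<tau>" using H that by blast
    show ?thesis
      using dual_bounded_on_bounded_in[OF subspace_0[OF sub] subspace_scale[OF sub] f B]
      by (auto simp: bdd_above_def)
  qed
  have le_p: "norm (f x) \<le> p f" if "f \<in> H" "x \<in> B" for f x
    unfolding p_def using bdd that by (intro cSUP_upper)
  have "\<exists>f x. f \<in> H \<and> x \<in> B \<and> p f > 4 ^ n \<and> norm (f x) > 3 / 4 * p f" for n :: nat
  proof -
    obtain f z where fz: "f \<in> H" "z \<in> B" "norm (f z) > 4 ^ n" using unbd by blast
    have pf: "p f > 4 ^ n" using le_p[OF fz(1,2)] fz(3) by simp
    moreover have "(0::real) < 4 ^ n" by simp
    ultimately have "3 / 4 * p f < p f" by linarith
    then obtain x where "x \<in> B" "norm (f x) > 3 / 4 * p f"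
      using less_cSUP_iff[OF _ bdd[OF fz(1)]] fz(2) unfolding p_def by blast
    then show ?thesis using fz(1) pf by blast
  qed
  then obtain f x where f: "\<And>n::nat. f n \<in> H" and x: "\<And>n. x n \<in> B"
      and big: "\<And>n. p (f n) > 4 ^ n" "\<And>n. norm (f n (x n)) > 3 / 4 * p (f n)"
    by metis
  \<comment> \<open>The weight is built into \<open>a\<close>, so that the signs chosen for
    \<open>a\<close> control the weighted sums: \<open>\<epsilon> j * a n j\<close> equals
    \<open>c j * f n (x j)\<close>.\<close>
  define a where "a n j = f n (x j) / 3 ^ j" for n j
  obtain \<epsilon> where \<epsilon>: "\<And>n. norm (\<epsilon> n) = 1"
      "\<And>n. norm (a n n) \<le> norm (\<Sum>j<Suc n. \<epsilon> j * a n j)"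
    using ex_signs_partial_sum_ge_diagonal[of a] by blast
  define c where "c j = \<epsilon> j / 3 ^ j" for j
  have nc: "norm (c j) = (1 / 3) ^ j" for j
    by (simp add: c_def norm_divide \<epsilon>(1) norm_power power_one_over divide_simps)
  have smc: "summable (\<lambda>j. norm (c j))"
    by (simp add: nc summable_geometric)
  have "(\<lambda>g. if g \<in> dual s \<tau> then \<Sum>j. c j * g (x j) else 0) \<in> canonical_map s \<tau> ` topspace \<tau>"
    using weighted_sum_in_bidual[OF vs sub B x smc]
    unfolding sr[unfolded semi_reflexive_def, symmetric] .
  then obtain y where y: "y \<in> topspace \<tau>"
      "canonical_map s \<tau> y = (\<lambda>g. if g \<in> dual s \<tau> then \<Sum>j. c j * g (x j) else 0)"
    by (elim imageE) simp
  have lower: "norm (f n y) \<ge> 1 / 4 * (4 / 3) ^ n" for n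
  proof -
    have fd: "f n \<in> dual s \<tau>" using f H by blast
    have eq: "f n y = (\<Sum>j. c j * f n (x j))"
      using fun_cong[OF y(2), of "f n"] fd by (simp add: canonical_map_def)
    have bd: "norm (c j * f n (x j)) \<le> (1 / 3) ^ j * p (f n)" for j
      unfolding norm_mult nc by (rule mult_left_mono[OF le_p[OF f x]]) simp
    have sg: "summable (\<lambda>j. (1 / 3 :: real) ^ j * p (f n))"
      by (intro summable_mult2 summable_geometric) simp
    have sm: "summable (\<lambda>j. c j * f n (x j))"
      by (rule summable_comparison_test'[OF sg]) (use bd in auto)
    \<comment> \<open>The tail starts at \<open>Suc n\<close>, so the diagonal term, which the signs
      protect from cancellation, belongs to the finite sum.\<close>
    define T where "T = (\<Sum>j. c (j + Suc n) * f n (x (j + Suc n)))"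
    have split: "f n y = T + (\<Sum>j<Suc n. c j * f n (x j))"
      unfolding eq T_def by (rule suminf_split_initial_segment[OF sm])
    \<comment> \<open>\<open>K\<close> bounds the first term of the tail. Summing with ratio 1/3
      multiplies it by 3/2, which turns \<open>(1 / 3) ^ Suc n\<close> into half of
      \<open>(1 / 3) ^ n\<close>.\<close>
    define K where "K = (1 / 3) ^ Suc n * p (f n)"
    have K: "(\<lambda>j. (1 / 3) ^ j * K) sums (3 / 2 * K)"
      using sums_mult2[OF geometric_sums[of "1 / 3 :: real"], of K] by simp
    have "norm T \<le> (\<Sum>j. (1 / 3) ^ j * K)"
      unfolding T_def
    proof (rule norm_suminf_le)
      show "norm (c (j + Suc n) * f n (x (j + Suc n))) \<le> (1 / 3) ^ j * K" for j
        using bd[of "j + Suc n"] by (simp only: K_def power_add mult.assoc)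
    qed (rule sums_summable[OF K])
    also have "\<dots> = 1 / 2 * (1 / 3) ^ n * p (f n)"
      unfolding sums_unique[OF K, symmetric] by (simp add: K_def)
    finally have T: "norm T \<le> 1 / 2 * (1 / 3) ^ n * p (f n)" .
    have "(\<Sum>j<Suc n. c j * f n (x j)) = (\<Sum>j<Suc n. \<epsilon> j * a n j)"
      by (simp add: a_def c_def)
    then have "norm (\<Sum>j<Suc n. c j * f n (x j)) \<ge> norm (a n n)"
      using \<epsilon>(2)[of n] by simp
    moreover have "norm (a n n) = (1 / 3) ^ n * norm (f n (x n))"
      by (simp add: a_def norm_divide norm_power power_one_over divide_simps)
    moreover have "3 / 4 * ((1 / 3) ^ n * p (f n)) \<le> (1 / 3) ^ n * norm (f n (x n))"
      unfolding mult.left_commute[of "3 / 4"] using big(2)[of n] by (intro mult_left_mono) auto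
    moreover have "norm (f n y) \<ge> norm (\<Sum>j<Suc n. c j * f n (x j)) - norm T"
      unfolding split by (metis add.commute norm_diff_ineq)
    ultimately have "norm (f n y) \<ge> 1 / 4 * ((1 / 3) ^ n * p (f n))"
      using T unfolding mult.assoc by linarith
    moreover have "(1 / 3) ^ n * p (f n) \<ge> (1 / 3) ^ n * 4 ^ n"
      using big(1)[of n] by (intro mult_left_mono) auto
    moreover have "(1 / 3 :: real) ^ n * 4 ^ n = (4 / 3) ^ n"
      by (simp add: power_mult_distrib[symmetric])
    ultimately show ?thesis by linarith
  qed
  obtain C where C: "\<forall>f\<in>H. norm (f y) \<le> C" using pw y(1) by blast
  obtain n where "4 * C < (4 / 3 :: real) ^ n"
    using real_arch_pow[of "4 / 3 :: real" "4 * C"] by auto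
  moreover have "1 / 4 * (4 / 3) ^ n \<le> C" using lower[of n] C f[of n] by (meson order_trans)
  ultimately show False by simp
qed

section \<open>The finest locally convex topology\<close>

lemma ext_seminorm_on_SUP:
  fixes s :: "'k::real_normed_field \<Rightarrow> 'a::ab_group_add \<Rightarrow> 'a"
  assumes "H \<subseteq> dual s \<tau>"
  shows "ext_seminorm_on s (topspace \<tau>) (\<lambda>x. SUP f\<in>H. ennreal (norm (f x)))"
  unfolding ext_seminorm_on_def
proof (intro conjI allI ballI)
  fix \<alpha> x assume x: "x \<in> topspace \<tau>"
  have "ennreal (norm (f (s \<alpha> x))) = ennreal (norm \<alpha>) * ennreal (norm (f x))" if "f \<in> H" for f
  proof -
    have "f (s \<alpha> x) = \<alpha> * f x" using that assms x unfolding dual_def by blast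
    then show ?thesis by (simp add: norm_mult ennreal_mult)
  qed
  then show "(SUP f\<in>H. ennreal (norm (f (s \<alpha> x)))) =
      ennreal (norm \<alpha>) * (SUP f\<in>H. ennreal (norm (f x)))"
    unfolding SUP_mult_left_ennreal by (rule SUP_cong[OF refl])
next
  fix x y assume xy: "x \<in> topspace \<tau>" "y \<in> topspace \<tau>"
  show "(SUP f\<in>H. ennreal (norm (f (x + y)))) \<le>
      (SUP f\<in>H. ennreal (norm (f x))) + (SUP f\<in>H. ennreal (norm (f y)))"
  proof (rule SUP_least)
    fix f assume f: "f \<in> H"
    have "f (x + y) = f x + f y" using f assms xy unfolding dual_def by blast
    then have "ennreal (norm (f (x + y))) \<le> ennreal (norm (f x)) + ennreal (norm (f y))"
      by (simp add: norm_triangle_ineq ennreal_leI flip: ennreal_plus)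
    also have "\<dots> \<le> (SUP f\<in>H. ennreal (norm (f x))) + (SUP f\<in>H. ennreal (norm (f y)))"
      using f by (intro add_mono SUP_upper)
    finally show "ennreal (norm (f (x + y))) \<le> \<dots>" .
  qed
qed

text \<open>Pointwise boundedness keeps the suprema finite, so the extended seminorms are ordinary
  ones. It is applied to a single functional and to the family of all bounded sets of the
  dual.\<close>

lemma locally_convex_pointwise_bounded:
  fixes s :: "'k::real_normed_field \<Rightarrow> 'a::ab_group_add \<Rightarrow> 'a"
  assumes "vector_space s" "module.subspace s (topspace \<tau>)"
    and bd: "\<And>H. H \<in> \<H> \<Longrightarrow> H \<subseteq> dual s \<tau> \<and> (\<forall>x\<in>topspace \<tau>. \<exists>C. \<forall>f\<in>H. norm (f x) \<le> C)"
  shows "locally_convex s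
    (seminorm_topology (topspace \<tau>) ((\<lambda>H x. SUP f\<in>H. ennreal (norm (f x))) ` \<H>))"
proof -
  have "(SUP f\<in>H. ennreal (norm (f x))) < \<infinity>" if H: "H \<in> \<H>" and x: "x \<in> topspace \<tau>" for H x
  proof -
    obtain C where C: "\<forall>f\<in>H. norm (f x) \<le> C" using bd[OF H] x by blast
    have "(SUP f\<in>H. ennreal (norm (f x))) \<le> ennreal C"
      using C by (intro SUP_least ennreal_leI) blast
    then show ?thesis by (simp add: le_less_trans)
  qed
  moreover have "ext_seminorm_on s (topspace \<tau>) (\<lambda>x. SUP f\<in>H. ennreal (norm (f x)))"
    if "H \<in> \<H>" for H
    using bd[OF that] by (intro ext_seminorm_on_SUP) simp
  ultimately have "\<forall>\<rho>\<in>(\<lambda>H x. SUP f\<in>H. ennreal (norm (f x))) ` \<H>.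
      ext_seminorm_on s (topspace \<tau>) \<rho> \<and> (\<forall>x\<in>topspace \<tau>. \<rho> x < \<infinity>)"
    by (intro ballI, elim imageE) simp
  then show ?thesis
    unfolding locally_convex_def topspace_seminorm_topology
    by (intro conjI exI assms(1,2)) (assumption | rule refl)+
qed

text \<open>If \<open>f\<close> is continuous for \<open>\<tau>\<close>, the seminorm
  \<open>norm (f x)\<close> alone induces a locally convex topology coarser than
  \<open>\<tau>\<close>, hence coarser than \<open>\<tau>F\<close>, and \<open>f\<close> is
  continuous for it.\<close>

lemma dual_flc_topology:
  fixes s :: "'k::real_normed_field \<Rightarrow> 'a::ab_group_add \<Rightarrow> 'a"
  assumes flc: "is_flc_topology s \<tau> \<tau>F"
  shows "dual s \<tau>F = dual s \<tau>"
proof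
  have co: "coarser \<tau>F \<tau>" and top: "topspace \<tau>F = topspace \<tau>"
    and vs: "vector_space s" and sub: "module.subspace s (topspace \<tau>)"
    using flc by (auto simp: is_flc_topology_def locally_convex_def coarser_def)
  show "dual s \<tau>F \<subseteq> dual s \<tau>"
    by (rule dual_coarser[OF co])
  show "dual s \<tau> \<subseteq> dual s \<tau>F"
  proof
    fix f assume f: "f \<in> dual s \<tau>"
    then have cont: "continuous_map \<tau> euclidean f" by (simp add: dual_def)
    \<comment> \<open>The single seminorm is written as a family of suprema over
      \<open>{{f}}\<close> to match \<open>locally_convex_pointwise_bounded\<close>.\<close>
    define \<sigma> where
      "\<sigma> = seminorm_topology (topspace \<tau>) ((\<lambda>H x. SUP f\<in>H. ennreal (norm (f x))) ` {{f}})"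
    have \<sigma>: "\<sigma> = seminorm_topology (topspace \<tau>) {\<lambda>x. ennreal (norm (f x))}"
      by (simp add: \<sigma>_def)
    have "locally_convex s \<sigma>"
      unfolding \<sigma>_def using f
      by (intro locally_convex_pointwise_bounded vs sub) auto
    moreover have "coarser \<sigma> \<tau>"
      unfolding coarser_def
    proof (intro conjI allI impI)
      fix U assume U: "openin \<sigma> U"
      show "openin \<tau> U"
      proof (subst openin_subopen, intro ballI)
        fix x assume "x \<in> U"
        then obtain F r where x: "x \<in> topspace \<tau>"
            and F: "F \<subseteq> {\<lambda>x. ennreal (norm (f x))}" "(r::real) > 0"
            "{y\<in>topspace \<tau>. \<forall>\<rho>\<in>F. \<rho> (y - x) < ennreal r} \<subseteq> U"
          using U unfolding \<sigma> openin_seminorm_topology by blast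
        define W where "W = {y\<in>topspace \<tau>. f y \<in> ball (f x) r}"
        have "openin \<tau> W"
          unfolding W_def using cont by (rule openin_continuous_map_preimage) simp
        moreover have "x \<in> W" using x F by (simp add: W_def)
        moreover have "W \<subseteq> U"
        proof
          fix y assume "y \<in> W"
          then have y: "y \<in> topspace \<tau>" "norm (f (y - x)) < r"
            using x dual_diff[OF vs sub f]
            by (auto simp: W_def dist_norm norm_minus_commute)
          then have "\<forall>\<rho>\<in>F. \<rho> (y - x) < ennreal r"
            using F(1) by (auto simp: ennreal_less_iff)
          then show "y \<in> U" using F(3) y(1) by blast
        qed
        ultimately show "\<exists>T. openin \<tau> T \<and> x \<in> T \<and> T \<subseteq> U" by blast
      qed
    qed (simp add: \<sigma>)
    ultimately have "coarser \<sigma> \<tau>F"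
      using flc by (simp add: is_flc_topology_def)
    moreover have "continuous_map \<sigma> euclidean f"
      unfolding \<sigma>
      by (rule continuous_map_seminorm_topologyI[of "\<lambda>x. ennreal (norm (f x))" _ _ _ 1])
        (auto simp: dual_diff[OF vs sub f] ennreal_less_iff)
    ultimately have "continuous_map \<tau>F euclidean f"
      by (rule continuous_map_coarser_domain)
    then show "f \<in> dual s \<tau>F" using f top by (simp add: dual_def)
  qed
qed

text \<open>
  Semi-reflexivity makes the images of the open sets of the pulled back topology open in the whole
  bidual.
\<close>

lemma continuous_canonical_map_flc:
  fixes s :: "'k::{real_normed_field,banach} \<Rightarrow> 'a::ab_group_add \<Rightarrow> 'a"
  assumes flc: "is_flc_topology s \<tau> \<tau>F" and sr: "semi_reflexive s \<tau>F"
    and cont: "continuous_map \<tau> (ucb_topology fscale (ucb_topology s \<tau>F)) (canonical_map s \<tau>F)"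
  shows "continuous_map \<tau>F (ucb_topology fscale (ucb_topology s \<tau>F)) (canonical_map s \<tau>F)"
proof -
  define V where "V = topspace \<tau>"
  define J where "J = canonical_map s \<tau>F"
  define D where "D = dual fscale (ucb_topology s \<tau>F)"
  define T where "T = ucb_topology fscale (ucb_topology s \<tau>F)"
  define \<H> where "\<H> = {H. bounded_in fscale (ucb_topology s \<tau>F) H}"
  define p where "p H \<Phi> = (SUP f\<in>H. ennreal (norm (\<Phi> f)))" for H :: "('a \<Rightarrow> 'k) set" and \<Phi> :: "('a \<Rightarrow> 'k) \<Rightarrow> 'k"
  define q where "q H x = (SUP f\<in>H. ennreal (norm (f x)))" for H :: "('a \<Rightarrow> 'k) set" and x
  \<comment> \<open>This is the topology pulled back along \<open>J\<close>, written with seminorms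
    on the space itself so that local convexity can be read off.\<close>
  define \<sigma> where "\<sigma> = seminorm_topology V (q ` \<H>)"
  have top: "topspace \<tau>F = V" and vs: "vector_space s" and sub: "module.subspace s V"
    using flc by (auto simp: is_flc_topology_def locally_convex_def coarser_def V_def)
  interpret vector_space s by (rule vs)
  have JV: "J ` V = D" using sr by (simp add: semi_reflexive_def J_def D_def top)
  have T: "T = seminorm_topology D (p ` \<H>)"
  proof -
    have "p = (\<lambda>H \<Phi>. SUP f\<in>H. ennreal (norm (\<Phi> f)))" by (intro ext p_def)
    then show ?thesis
      unfolding T_def ucb_topology_def[of fscale] D_def \<H>_def by (simp only: setcompr_eq_image)
  qed
  have topT: "topspace T = D" by (simp add: T)
  \<comment> \<open>\<open>J\<close> preserves distances for each pair \<open>p H\<close>,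
    \<open>q H\<close>, so basic neighbourhoods on the two sides correspond.\<close>
  have pq: "p H (J y - J x) = q H (y - x)" if "H \<in> \<H>" "x \<in> V" "y \<in> V" for H x y
    unfolding p_def q_def
  proof (rule SUP_cong[OF refl])
    fix f assume "f \<in> H"
    then have f: "f \<in> dual s \<tau>F" using that(1) by (auto simp: \<H>_def bounded_in_def)
    have "f (y - x) = f y - f x"
      using that sub by (intro dual_diff[OF vs _ f]) (simp_all add: top)
    with f show "ennreal (norm ((J y - J x) f)) = ennreal (norm (f (y - x)))"
      by (simp add: J_def canonical_map_def)
  qed
  have ball: "(\<forall>\<rho>\<in>p ` G. \<rho> (J y - J x) < ennreal r) \<longleftrightarrow> (\<forall>\<rho>\<in>q ` G. \<rho> (y - x) < ennreal r)"
    if "G \<subseteq> \<H>" "x \<in> V" "y \<in> V" for G x y r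
    using pq[OF subsetD[OF that(1)] that(2,3)] by simp
  have "locally_convex s \<sigma>"
  proof -
    have "H \<subseteq> dual s \<tau>F \<and> (\<forall>x\<in>topspace \<tau>F. \<exists>C. \<forall>f\<in>H. norm (f x) \<le> C)" if "H \<in> \<H>" for H
    proof -
      have H: "bounded_in fscale (ucb_topology s \<tau>F) H" using that by (simp add: \<H>_def)
      then have "H \<subseteq> dual s \<tau>F" by (simp add: bounded_in_def)
      then show ?thesis
        using bounded_in_ucb_imp_pointwise_bounded[OF vs _ H] sub unfolding top by blast
    qed
    then have "locally_convex s (seminorm_topology (topspace \<tau>F)
        ((\<lambda>H x. SUP f\<in>H. ennreal (norm (f x))) ` \<H>))"
      using sub by (intro locally_convex_pointwise_bounded vs) (auto simp: top)
    moreover have "q = (\<lambda>H x. SUP f\<in>H. ennreal (norm (f x)))"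
      by (intro ext q_def)
    ultimately show ?thesis by (simp only: \<sigma>_def top)
  qed
  moreover have "coarser \<sigma> \<tau>"
    unfolding coarser_def
  proof (intro conjI allI impI)
    fix U assume U: "openin \<sigma> U"
    then have UV: "U \<subseteq> V" by (simp add: \<sigma>_def openin_seminorm_topology)
    have nbhd: "\<exists>G r. finite G \<and> G \<subseteq> \<H> \<and> (r::real) > 0 \<and>
        {y\<in>V. \<forall>\<rho>\<in>q ` G. \<rho> (y - x) < ennreal r} \<subseteq> U" if x: "x \<in> U" for x
    proof -
      obtain F r where F: "finite F" "F \<subseteq> q ` \<H>" "(r::real) > 0"
          "{y\<in>V. \<forall>\<rho>\<in>F. \<rho> (y - x) < ennreal r} \<subseteq> U"
        using U x unfolding \<sigma>_def openin_seminorm_topology by blast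
      then show ?thesis using finite_subset_image[OF F(1,2)] by blast
    qed
    have "openin T (J ` U)"
      unfolding T openin_seminorm_topology
    proof (intro conjI ballI)
      show "J ` U \<subseteq> D" using UV JV by blast
      fix \<Phi> assume "\<Phi> \<in> J ` U"
      then obtain x where x: "x \<in> U" "\<Phi> = J x" by blast
      obtain G r where G: "finite G" "G \<subseteq> \<H>" "(r::real) > 0"
          "{y\<in>V. \<forall>\<rho>\<in>q ` G. \<rho> (y - x) < ennreal r} \<subseteq> U"
        using nbhd[OF x(1)] by (elim exE conjE)
      have "{\<Psi> \<in> D. \<forall>\<rho>\<in>p ` G. \<rho> (\<Psi> - \<Phi>) < ennreal r} \<subseteq> J ` U"
      proof
        fix \<Psi> assume \<Psi>: "\<Psi> \<in> {\<Psi> \<in> D. \<forall>\<rho>\<in>p ` G. \<rho> (\<Psi> - \<Phi>) < ennreal r}"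
        then obtain y where y: "y \<in> V" "\<Psi> = J y" using JV by blast
        have "\<forall>\<rho>\<in>p ` G. \<rho> (J y - J x) < ennreal r"
          using \<Psi> unfolding x(2) y(2) by blast
        then have "\<forall>\<rho>\<in>q ` G. \<rho> (y - x) < ennreal r"
          using ball[OF G(2) subsetD[OF UV x(1)] y(1)] by blast
        then show "\<Psi> \<in> J ` U" using G(4) y by blast
      qed
      then show "\<exists>F r. finite F \<and> F \<subseteq> p ` \<H> \<and> (r::real) > 0 \<and>
          {\<Psi> \<in> D. \<forall>\<rho>\<in>F. \<rho> (\<Psi> - \<Phi>) < ennreal r} \<subseteq> J ` U"
        using G(3) finite_imageI[OF G(1)] image_mono[OF G(2)]
        by (intro exI[of _ "p ` G"] exI[of _ r] conjI)
    qed
    then have "openin \<tau> {x \<in> V. J x \<in> J ` U}"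
      unfolding V_def J_def T_def by (rule openin_continuous_map_preimage[OF cont])
    \<comment> \<open>\<open>J\<close> may identify points, but for such points
      \<open>q H (y - x)\<close> equals \<open>p H 0\<close>, which is 0, so every open set of
      \<open>\<sigma>\<close> contains both or neither.\<close>
    moreover have "{x \<in> V. J x \<in> J ` U} = U"
    proof
      show "{x \<in> V. J x \<in> J ` U} \<subseteq> U"
      proof
        fix y assume "y \<in> {x \<in> V. J x \<in> J ` U}"
        then obtain x where x: "x \<in> U" "J y = J x" and y: "y \<in> V" by auto
        obtain G r where G: "G \<subseteq> \<H>" "(r::real) > 0"
            "{y\<in>V. \<forall>\<rho>\<in>q ` G. \<rho> (y - x) < ennreal r} \<subseteq> U"
          using nbhd[OF x(1)] by (elim exE conjE)
        have "p H 0 < ennreal r" for H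
          unfolding p_def using G(2) by (intro SUP_ennreal_norm_lessI[of _ _ 0]) auto
        then have "\<forall>\<rho>\<in>p ` G. \<rho> (J y - J x) < ennreal r"
          unfolding x(2) diff_self by blast
        then have "\<forall>\<rho>\<in>q ` G. \<rho> (y - x) < ennreal r"
          using ball[OF G(1) subsetD[OF UV x(1)] y] by blast
        then show "y \<in> U" using G(3) y by blast
      qed
    qed (use UV in auto)
    ultimately show "openin \<tau> U" by simp
  qed (simp add: \<sigma>_def V_def)
  ultimately have co: "coarser \<sigma> \<tau>F"
    using flc by (simp add: is_flc_topology_def)
  have "continuous_map \<sigma> T J"
    unfolding continuous_map
  proof (intro conjI allI impI)
    show "J ` topspace \<sigma> \<subseteq> topspace T" using JV by (simp add: \<sigma>_def topT)
    fix W assume W: "openin T W"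
    show "openin \<sigma> {x \<in> topspace \<sigma>. J x \<in> W}"
      unfolding \<sigma>_def openin_seminorm_topology topspace_seminorm_topology
    proof (intro conjI ballI)
      fix x assume x: "x \<in> {x \<in> V. J x \<in> W}"
      then obtain F r where F: "finite F" "F \<subseteq> p ` \<H>" "(r::real) > 0"
          "{\<Phi>\<in>D. \<forall>\<rho>\<in>F. \<rho> (\<Phi> - J x) < ennreal r} \<subseteq> W"
        using W unfolding T openin_seminorm_topology by blast
      obtain G where G: "finite G" "G \<subseteq> \<H>" "F = p ` G"
        using finite_subset_image[OF F(1,2)] by blast
      have xV: "x \<in> V" using x by blast
      have "{y \<in> V. \<forall>\<rho>\<in>q ` G. \<rho> (y - x) < ennreal r} \<subseteq> {x \<in> V. J x \<in> W}"
      proof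
        fix y assume y: "y \<in> {y \<in> V. \<forall>\<rho>\<in>q ` G. \<rho> (y - x) < ennreal r}"
        then have yV: "y \<in> V" by blast
        have "\<forall>\<rho>\<in>F. \<rho> (J y - J x) < ennreal r"
          unfolding G(3) ball[OF G(2) xV yV] using y by blast
        moreover have "J y \<in> D" using JV yV by blast
        ultimately show "y \<in> {x \<in> V. J x \<in> W}" using F(4) yV by blast
      qed
      then show "\<exists>F r. finite F \<and> F \<subseteq> q ` \<H> \<and> (r::real) > 0 \<and>
          {y \<in> V. \<forall>\<rho>\<in>F. \<rho> (y - x) < ennreal r} \<subseteq> {x \<in> V. J x \<in> W}"
        using F(3) finite_imageI[OF G(1)] image_mono[OF G(2)]
        by (intro exI[of _ "q ` G"] exI[of _ r] conjI)
    qed auto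
  qed
  then show ?thesis
    using continuous_map_coarser_domain[OF co] by (simp add: T_def J_def)
qed

section \<open>Comparing the biduals\<close>

text \<open>The order reverses: a set bounded for \<open>\<tau>\<close> is bounded for the coarser
  \<open>\<sigma>\<close>, so \<open>\<sigma>\<close> contributes at least as many seminorms on the
  common dual.\<close>

lemma ucb_topology_coarser:
  assumes "coarser \<sigma> \<tau>" "dual s \<sigma> = dual s \<tau>"
  shows "coarser (ucb_topology s \<tau>) (ucb_topology s \<sigma>)"
  unfolding ucb_topology_def assms(2)
  by (rule seminorm_topology_mono) (use bounded_in_coarser[OF assms(1)] in blast)

lemma bidual_flc_topology:
  fixes s :: "'k::{real_normed_field,banach} \<Rightarrow> 'a::ab_group_add \<Rightarrow> 'a"
  assumes flc: "is_flc_topology s \<tau> \<tau>F" and sr: "semi_reflexive s \<tau>F"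
  shows "canonical_map s \<tau> = canonical_map s \<tau>F" "semi_reflexive s \<tau>"
    and "ucb_topology fscale (ucb_topology s \<tau>) = ucb_topology fscale (ucb_topology s \<tau>F)"
proof -
  have co: "coarser \<tau>F \<tau>" and top: "topspace \<tau>F = topspace \<tau>"
    and vs: "vector_space s" and sub: "module.subspace s (topspace \<tau>)"
    using flc by (auto simp: is_flc_topology_def locally_convex_def coarser_def)
  have dual: "dual s \<tau>F = dual s \<tau>" by (rule dual_flc_topology[OF flc])
  show J: "canonical_map s \<tau> = canonical_map s \<tau>F"
    by (simp add: canonical_map_def fun_eq_iff dual)
  have ucb: "coarser (ucb_topology s \<tau>) (ucb_topology s \<tau>F)"
    by (rule ucb_topology_coarser[OF co dual])
  \<comment> \<open>Semi-reflexivity of \<open>\<tau>\<close> by squeezing: its bidual lies in that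
    of \<open>\<tau>F\<close>, which consists of evaluations, and evaluations always belong to the
    bidual of \<open>\<tau>\<close>.\<close>
  have "dual fscale (ucb_topology s \<tau>) \<subseteq> dual fscale (ucb_topology s \<tau>F)"
    by (rule dual_coarser[OF ucb])
  also have "\<dots> = canonical_map s \<tau> ` topspace \<tau>"
    using sr by (simp add: semi_reflexive_def J top)
  finally have le: "dual fscale (ucb_topology s \<tau>) \<subseteq> canonical_map s \<tau> ` topspace \<tau>" .
  then show sr': "semi_reflexive s \<tau>"
    unfolding semi_reflexive_def using canonical_map_in_bidual[OF vs sub] by blast
  have "bounded_in fscale (ucb_topology s \<tau>) H \<longleftrightarrow> bounded_in fscale (ucb_topology s \<tau>F) H" for H
  proof
    assume "bounded_in fscale (ucb_topology s \<tau>F) H"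
    then show "bounded_in fscale (ucb_topology s \<tau>) H" by (rule bounded_in_coarser[OF ucb])
  next
    \<comment> \<open>Here the gliding hump enters: \<open>H\<close> is pointwise bounded, hence
      uniformly bounded on every set bounded for \<open>\<tau>F\<close>, hence bounded in the finer
      topology of the dual.\<close>
    assume H: "bounded_in fscale (ucb_topology s \<tau>) H"
    then have HF: "H \<subseteq> dual s \<tau>F" by (simp add: bounded_in_def dual)
    show "bounded_in fscale (ucb_topology s \<tau>F) H"
    proof (rule uniformly_bounded_imp_bounded_in_ucb[OF HF])
      fix B assume "bounded_in s \<tau>F B"
      then show "\<exists>C. \<forall>f\<in>H. \<forall>x\<in>B. norm (f x) \<le> C"
        using bounded_in_ucb_imp_pointwise_bounded[OF vs sub H]
        by (intro pointwise_bounded_imp_uniformly_bounded[OF vs _ sr _ HF]) (auto simp: top sub)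
    qed
  qed
  \<comment> \<open>The topology of a bidual is determined by its functionals and by the bounded
    sets of the dual; both now agree.\<close>
  moreover have "dual fscale (ucb_topology s \<tau>) = dual fscale (ucb_topology s \<tau>F)"
    using sr sr' by (simp add: semi_reflexive_def J top)
  ultimately show "ucb_topology fscale (ucb_topology s \<tau>) = ucb_topology fscale (ucb_topology s \<tau>F)"
    by (simp add: ucb_topology_def[of fscale])
qed

theorem theorem3p10:
  fixes s :: "'k::real_or_complex \<Rightarrow> 'a::ab_group_add \<Rightarrow> 'a"
    and \<tau> \<tau>F :: "'a topology"
  assumes "elcs s \<tau>"
    and "is_flc_topology s \<tau> \<tau>F"
  shows "(reflexive_space s \<tau>F \<longrightarrow> reflexive_space s \<tau>) \<and>
         (reflexive_space s \<tau> \<and> semi_reflexive s \<tau>F \<longrightarrow> reflexive_space s \<tau>F)"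
proof -
  have co: "coarser \<tau>F \<tau>" using assms(2) by (simp add: is_flc_topology_def)
  \<comment> \<open>Both implications reduce to this equivalence, since reflexivity of
    \<open>\<tau>F\<close> includes its semi-reflexivity. After identifying the biduals only the
    source topology of one and the same map differs.\<close>
  have "reflexive_space s \<tau> \<longleftrightarrow> reflexive_space s \<tau>F" if sr: "semi_reflexive s \<tau>F"
    unfolding reflexive_space_def bidual_flc_topology[OF assms(2) sr]
    using sr bidual_flc_topology(2)[OF assms(2) sr] continuous_map_coarser_domain[OF co]
      continuous_canonical_map_flc[OF assms(2) sr]
    by blast
  then show ?thesis by (auto simp: reflexive_space_def)
qed

end
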